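(* Let $\alpha, \beta$ be real numbers with $\alpha \geq 0$, $\beta \geq 0$, and $\alpha + \beta < 1$. Then $$\liminf_{n \to \infty} p_n^\beta \left( p_{n+1}^\alpha - p_n^\alpha \right) = 0,$$ where $p_n$ denotes the $n$th prime number.
   Context: For each integer $n \geq 1$, $p_n$ denotes the $n$th prime number (so $p_1 = 2$, $p_2 = 3$, $p_3 = 5$, and so on). *)

theory Defs
  imports "HOL-Analysis.Analysis" "HOL-Computational_Algebra.Primes"
begin

(* The library's enumeration of an infinite set starts at index 0, whereas primes are
   counted from 1: nth_prime 1 = 2, nth_prime 2 = 3, nth_prime 3 = 5.
   The value at 0 is junk (it is 2). *)
definition nth_prime :: "nat \<Rightarrow> nat" where
  "nth_prime n = enumerate {p. prime p} (n - 1)"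

lemma prime_nth_prime: "prime (nth_prime n)"
  using enumerate_in_set[OF primes_infinite] by (auto simp: nth_prime_def)

lemma nth_prime_less_Suc: "n \<ge> 1 \<Longrightarrow> nth_prime n < nth_prime (n + 1)"
  using enumerate_step[OF primes_infinite, of "n - 1"] by (simp add: nth_prime_def)

lemma nth_prime_surj: "prime p \<Longrightarrow> \<exists>n\<ge>1. nth_prime n = p"
  using enumerate_Ex[of "{p. prime p}" p] primes_infinite
  by (metis (mono_tags, lifting) One_nat_def diff_Suc_1 le_add1 mem_Collect_eq nth_prime_def plus_1_eq_Suc)

end

theory Submission
  imports Defs "HOL-Computational_Algebra.Squarefree"
begin

text \<open>
  Put \<open>\<epsilon> = 1 - \<alpha> - \<beta>\<close>, so \<open>0 < \<epsilon> \<le> 1\<close>. By the mean value theorem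
  the \<open>n\<close>-th term is at most \<open>(p\<^sub>n\<^sub>+\<^sub>1 - p\<^sub>n) / p\<^sub>n\<^sup>\<epsilon>\<close>
  (\<open>powr_weighted_diff_le\<close>). A positive lower limit would therefore force
  prime gaps of size at least \<open>c p\<^sub>n\<^sup>\<epsilon>\<close> from some point on, for some \<open>c > 0\<close>. A sequence
  whose gaps are that large grows so fast that its reciprocals are summable: each step lowers
  \<open>x\<^sup>-\<^sup>\<epsilon>\<close> by at least a constant times \<open>1 / x\<close>, and these decrements telescope
  (\<open>summable_inverse_of_powr_gaps\<close>). The reciprocals of the primes, however, are not
  summable (\<open>not_summable_inverse_nth_prime\<close>).

  Divergence of the prime reciprocals is shown by Erdos's counting argument. If it failed, the
  primes beyond some \<open>K\<close> would have reciprocal sum below one half, so fewer than half of the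
  numbers up to \<open>N\<close> would have a prime factor beyond \<open>K\<close>. The others are a square
  times one of at most \<open>2\<^sup>K\<close> squarefree numbers, so there are only \<open>O(\<surd>N)\<close> of
  them.
\<close>

section \<open>Divergence of the sum of prime reciprocals\<close>

text \<open>
  A squarefree number is the product of the set of its prime factors, which is a subset of
  \<open>{1..K}\<close> here; the square part leaves at most \<open>\<surd>N\<close> choices.
\<close>

lemma card_smooth_le:
  fixes K N :: nat
  shows "real (card {n\<in>{1..N}. \<forall>p. prime p \<longrightarrow> p dvd n \<longrightarrow> p \<le> K}) \<le> 2 ^ K * sqrt N"
proof -
  define S where "S = {n\<in>{1..N}. \<forall>p. prime p \<longrightarrow> p dvd n \<longrightarrow> p \<le> K}"
  define R where "R = nat \<lfloor>sqrt N\<rfloor>"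
  define f where "f = (\<lambda>(A, m). \<Prod>A * m ^ 2 :: nat)"
  have "S \<subseteq> f ` (Pow {1..K} \<times> {1..R})"
  proof
    fix n assume n: "n \<in> S"
    define s where "s = squarefree_part n"
    define m where "m = square_part n"
    have nsm: "n = s * m ^ 2"
      unfolding s_def m_def by (rule squarefree_decompose)
    have "n > 0" "n \<le> N" using n by (auto simp: S_def)
    have "m > 0" "s > 0" using nsm \<open>n > 0\<close> by (cases m; cases s; simp)+
    have "m ^ 2 \<le> s * m ^ 2" using \<open>s > 0\<close> by simp
    also have "\<dots> \<le> N" using nsm \<open>n \<le> N\<close> by simp
    finally have "real (m ^ 2) \<le> real N" by (rule of_nat_mono)
    then have "real m ^ 2 \<le> real N" by simp
    then have "real m \<le> sqrt N" by (rule real_le_rsqrt)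
    then have "m \<le> R" by (simp add: R_def le_nat_floor)
    have "s = (\<Prod>p\<in>prime_factors s. p ^ multiplicity p s)"
      using \<open>s > 0\<close> by (rule prime_factorization_nat)
    also have "\<dots> = \<Prod>(prime_factors s)"
    proof (rule prod.cong[OF refl])
      fix p assume p: "p \<in> prime_factors s"
      then have "multiplicity p s > 0"
        using \<open>s > 0\<close> by (simp add: prime_factors_multiplicity)
      moreover have "multiplicity p s \<le> 1"
        using prime_multiplicity_squarefree_part_le_Suc_0[of p n] p by (auto simp: s_def)
      ultimately have "multiplicity p s = 1" by simp
      then show "p ^ multiplicity p s = p" by simp
    qed
    finally have "\<Prod>(prime_factors s) = s" by (rule sym)
    moreover have "prime_factors s \<subseteq> {1..K}"
    proof
      fix p assume p: "p \<in> prime_factors s"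
      then have "prime p" "p dvd s" by auto
      then have "p dvd n" by (subst nsm) (rule dvd_mult2)
      then show "p \<in> {1..K}" using n \<open>prime p\<close> by (auto simp: S_def prime_ge_1_nat)
    qed
    ultimately show "n \<in> f ` (Pow {1..K} \<times> {1..R})"
      using nsm \<open>m > 0\<close> \<open>m \<le> R\<close>
      by (intro image_eqI[of _ _ "(prime_factors s, m)"]) (auto simp: f_def)
  qed
  then have "card S \<le> card (f ` (Pow {1..K} \<times> {1..R}))"
    by (intro card_mono) auto
  also have "\<dots> \<le> card (Pow {1..K} \<times> {1..R})"
    by (intro card_image_le) auto
  also have "\<dots> = 2 ^ K * R"
    by (simp add: card_cartesian_product card_Pow)
  finally have "real (card S) \<le> real (2 ^ K * R)"
    by (rule of_nat_mono)
  then have "real (card S) \<le> 2 ^ K * real R" by simp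
  also have "\<dots> \<le> 2 ^ K * sqrt N" by (simp add: R_def)
  finally show ?thesis by (simp add: S_def)
qed

lemma card_rough_le:
  fixes K N :: nat
  shows "real (card {n\<in>{1..N}. \<exists>p. prime p \<and> p dvd n \<and> K < p})
           \<le> real N * (\<Sum>p | prime p \<and> K < p \<and> p \<le> N. 1 / real p)"
proof -
  define P where "P = {p. prime p \<and> K < p \<and> p \<le> N}"
  have fin: "finite P" unfolding P_def by (rule finite_subset[of _ "{..N}"]) auto
  have "{n\<in>{1..N}. \<exists>p. prime p \<and> p dvd n \<and> K < p} \<subseteq> (\<Union>p\<in>P. {n\<in>{1..N}. p dvd n})"
  proof
    fix n assume "n \<in> {n\<in>{1..N}. \<exists>p. prime p \<and> p dvd n \<and> K < p}"
    then obtain p where n: "n \<in> {1..N}" and p: "prime p" "p dvd n" "K < p" by blast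
    have "p \<le> N" using dvd_imp_le[OF p(2)] n by simp
    then show "n \<in> (\<Union>p\<in>P. {n\<in>{1..N}. p dvd n})" using n p by (intro UN_I[of p]) (auto simp: P_def)
  qed
  then have "card {n\<in>{1..N}. \<exists>p. prime p \<and> p dvd n \<and> K < p}
               \<le> card (\<Union>p\<in>P. {n\<in>{1..N}. p dvd n})"
    using fin by (intro card_mono) auto
  also have "\<dots> \<le> (\<Sum>p\<in>P. card {n\<in>{1..N}. p dvd n})"
    by (rule card_UN_le[OF fin])
  finally have "real (card {n\<in>{1..N}. \<exists>p. prime p \<and> p dvd n \<and> K < p})
                  \<le> real (\<Sum>p\<in>P. card {n\<in>{1..N}. p dvd n})"
    by (rule of_nat_mono)
  also have "\<dots> = (\<Sum>p\<in>P. real (card {n\<in>{1..N}. p dvd n}))"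
    by (rule of_nat_sum)
  also have "\<dots> \<le> (\<Sum>p\<in>P. real N * (1 / real p))"
  proof (rule sum_mono)
    fix p assume "p \<in> P"
    then have "p > 0" by (auto simp: P_def prime_gt_0_nat)
    have "{n\<in>{1..N}. p dvd n} \<subseteq> (\<lambda>k. p * k) ` {1..N div p}"
    proof
      fix n assume n: "n \<in> {n\<in>{1..N}. p dvd n}"
      then obtain k where k: "n = p * k" by auto
      then have "k \<ge> 1" using n by (cases k) auto
      moreover have "k \<le> N div p"
        using n \<open>p > 0\<close> by (simp add: less_eq_div_iff_mult_less_eq k mult.commute)
      ultimately show "n \<in> (\<lambda>k. p * k) ` {1..N div p}" using k by auto
    qed
    then have "card {n\<in>{1..N}. p dvd n} \<le> card {1..N div p}"
      by (meson surj_card_le finite_atLeastAtMost)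
    then have "real (card {n\<in>{1..N}. p dvd n}) \<le> real (N div p)" by simp
    also have "\<dots> \<le> real N / real p" by (rule of_nat_div_le_of_nat)
    finally show "real (card {n\<in>{1..N}. p dvd n}) \<le> real N * (1 / real p)" by simp
  qed
  finally show ?thesis by (simp add: P_def sum_distrib_left)
qed

text \<open>
  Smooth numbers are sparse and rough ones are few if the tail of the series is small, so
  together they cannot exhaust \<open>{1..N}\<close>.
\<close>

lemma not_summable_inverse_nth_prime: "\<not> summable (\<lambda>n. 1 / real (nth_prime n))"
proof
  assume "summable (\<lambda>n. 1 / real (nth_prime n))"
  then obtain M where M: "\<And>m n. m \<ge> M \<Longrightarrow> norm (\<Sum>i=m..<n. 1 / real (nth_prime i)) < 1/2"
    unfolding summable_Cauchy by (metis half_gt_zero zero_less_one)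
  define K where "K = nth_prime M"
  define N :: nat where "N = 4 * (2 ^ K) ^ 2"
  have tail: "(\<Sum>p | prime p \<and> K < p \<and> p \<le> N. 1 / real p) < 1/2"
  proof -
    have sub: "{p. prime p \<and> K < p \<and> p \<le> N} \<subseteq> nth_prime ` {M..<N+2}"
    proof
      fix p assume "p \<in> {p. prime p \<and> K < p \<and> p \<le> N}"
      then have p: "prime p" "K < p" "p \<le> N" by auto
      then obtain n where n: "n \<ge> 1" "nth_prime n = p" using nth_prime_surj by blast
      have "n - 1 \<le> p"
        using le_enumerate[OF primes_infinite, of "n - 1"] n(2) by (simp add: nth_prime_def)
      moreover have "n \<ge> M"
      proof (rule ccontr)
        assume "\<not> n \<ge> M"
        then have "nth_prime n \<le> nth_prime M"
          using primes_infinite by (simp add: nth_prime_def)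
        then show False using n p by (simp add: K_def)
      qed
      ultimately show "p \<in> nth_prime ` {M..<N+2}" using n p by (intro image_eqI[of _ _ n]) auto
    qed
    have "(\<Sum>p | prime p \<and> K < p \<and> p \<le> N. 1 / real p)
            \<le> (\<Sum>p\<in>nth_prime ` {M..<N+2}. 1 / real p)"
      by (rule sum_mono2[OF _ sub]) auto
    also have "\<dots> \<le> (\<Sum>i=M..<N+2. 1 / real (nth_prime i))"
      using sum_image_le[of "{M..<N+2}" "\<lambda>p. 1 / real p" nth_prime] by (simp add: o_def)
    also have "\<dots> < 1/2" using M[of M "N+2"] by simp
    finally show ?thesis .
  qed
  have "N > 0" by (simp add: N_def)
  have "{1..N} = {n\<in>{1..N}. \<forall>p. prime p \<longrightarrow> p dvd n \<longrightarrow> p \<le> K}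
                  \<union> {n\<in>{1..N}. \<exists>p. prime p \<and> p dvd n \<and> K < p}"
    by (auto simp: not_less)
  then have "N \<le> card {n\<in>{1..N}. \<forall>p. prime p \<longrightarrow> p dvd n \<longrightarrow> p \<le> K}
               + card {n\<in>{1..N}. \<exists>p. prime p \<and> p dvd n \<and> K < p}"
    by (metis (no_types, lifting) card_Un_le card_atLeastAtMost diff_Suc_1)
  then have "real N \<le> real (card {n\<in>{1..N}. \<forall>p. prime p \<longrightarrow> p dvd n \<longrightarrow> p \<le> K})
               + real (card {n\<in>{1..N}. \<exists>p. prime p \<and> p dvd n \<and> K < p})"
    by linarith
  also have "\<dots> \<le> 2 ^ K * sqrt N + real N * (\<Sum>p | prime p \<and> K < p \<and> p \<le> N. 1 / real p)"
    by (intro add_mono card_smooth_le card_rough_le)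
  also have "\<dots> < 2 ^ K * sqrt N + real N * (1/2)"
    using tail \<open>N > 0\<close> by simp
  \<comment> \<open>\<open>N\<close> was chosen so that the smooth numbers account for at most the other half.\<close>
  also have "2 ^ K * sqrt N = real N * (1/2)"
    by (simp add: N_def real_sqrt_mult power2_eq_square)
  finally show False by simp
qed

section \<open>Sequences with large gaps\<close>

text \<open>
  The decrement of \<open>x\<^sup>-\<^sup>\<epsilon>\<close> from \<open>x n\<close> to \<open>x (n + 1)\<close> is bounded below by
  the one from \<open>x n\<close> to \<open>z = x n + c x n\<^sup>\<epsilon>\<close>. The gap itself has no upper bound, but
  \<open>z \<le> (1 + c) x n\<close>, so the mean value theorem costs only a constant factor there.
\<close>

lemma summable_inverse_of_powr_gaps:
  fixes x :: "nat \<Rightarrow> real" and c \<epsilon> :: real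
  assumes "c > 0" "0 < \<epsilon>" "\<epsilon> \<le> 1" and ge1: "\<And>n. x n \<ge> 1"
    and gap: "\<forall>\<^sub>F n in sequentially. x n + c * x n powr \<epsilon> \<le> x (Suc n)"
  shows "summable (\<lambda>n. 1 / x n)"
proof -
  define u where "u = (\<lambda>n. x n powr (-\<epsilon>))"
  define C where "C = \<epsilon> * c * (1 + c) powr (-\<epsilon>-1)"
  have "C > 0" using assms by (simp add: C_def)
  have dec: "C / x n \<le> u n - u (Suc n)" if g: "x n + c * x n powr \<epsilon> \<le> x (Suc n)" for n
  proof -
    define z where "z = x n + c * x n powr \<epsilon>"
    have x: "x n \<ge> 1" by (rule ge1)
    then have pos: "c * x n powr \<epsilon> > 0" using \<open>c > 0\<close> by simp
    have "x n powr \<epsilon> \<le> x n powr 1" using x assms(1-3) by (intro powr_mono) auto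
    then have z_le: "z \<le> (1 + c) * x n" using x assms(1-3) by (simp add: z_def algebra_simps)
    have xz: "x n < z" using pos by (simp add: z_def)
    have "\<exists>t. x n < t \<and> t < z \<and>
            z powr (-\<epsilon>) - x n powr (-\<epsilon>) = (z - x n) * (-\<epsilon> * t powr (-\<epsilon>-1))"
      using xz x by (intro MVT2) (auto intro!: derivative_eq_intros)
    then obtain t where t: "x n < t" "t < z"
      "z powr (-\<epsilon>) - x n powr (-\<epsilon>) = (z - x n) * (-\<epsilon> * t powr (-\<epsilon>-1))" by blast
    have "C / x n = (c * x n powr \<epsilon>) * (\<epsilon> * ((1 + c) * x n) powr (-\<epsilon>-1))"
    proof -
      have "x n powr \<epsilon> * x n powr (-\<epsilon>-1) = 1 / x n"
        using x by (simp add: powr_add[symmetric] powr_minus_divide)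
      then have "C / x n = \<epsilon> * c * (1 + c) powr (-\<epsilon>-1) * (x n powr \<epsilon> * x n powr (-\<epsilon>-1))"
        by (simp add: C_def)
      then show ?thesis using x assms(1-3) by (simp add: powr_mult mult_ac)
    qed
    also have "\<dots> \<le> (c * x n powr \<epsilon>) * (\<epsilon> * t powr (-\<epsilon>-1))"
      using x t z_le assms(1-3) by (intro mult_left_mono powr_mono2') auto
    also have "\<dots> = x n powr (-\<epsilon>) - z powr (-\<epsilon>)"
      using t(3) by (simp add: z_def)
    also have "\<dots> \<le> x n powr (-\<epsilon>) - x (Suc n) powr (-\<epsilon>)"
      using g[folded z_def] xz x assms(1-3) by (intro diff_left_mono powr_mono2') auto
    finally show ?thesis by (simp add: u_def)
  qed
  from gap obtain N where N: "\<And>n. n \<ge> N \<Longrightarrow> x n + c * x n powr \<epsilon> \<le> x (Suc n)"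
    unfolding eventually_sequentially by blast
  have "decseq (\<lambda>n. u (n + N))"
  proof (rule decseq_SucI)
    fix n
    have "0 \<le> C / x (n + N)" using \<open>C > 0\<close> ge1[of "n + N"] by simp
    then show "u (Suc n + N) \<le> u (n + N)" using dec[OF N[of "n + N"]] by simp
  qed
  moreover have "\<And>n. 0 \<le> u (n + N)" by (simp add: u_def)
  ultimately obtain L where "(\<lambda>n. u (n + N)) \<longlonglongrightarrow> L"
    using decseq_convergent[of "\<lambda>n. u (n + N)" 0] by blast
  then have "summable (\<lambda>n. u (n + N) - u (Suc n + N))"
    by (rule telescope_summable')
  then have "summable (\<lambda>n. C / x (n + N))"
  proof (rule summable_comparison_test')
    fix n
    show "norm (C / x (n + N)) \<le> u (n + N) - u (Suc n + N)"
      using dec[OF N[of "n + N"]] \<open>C > 0\<close> ge1[of "n + N"] by simp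
  qed
  then have "summable (\<lambda>n. C * (1 / x n))"
    using summable_iff_shift[of "\<lambda>n. C / x n" N] by simp
  then show ?thesis
    using \<open>C > 0\<close> by (subst (asm) summable_cmult_iff) auto
qed

section \<open>The lower limit\<close>

text \<open>
  As \<open>\<alpha> \<le> 1\<close>, the derivative \<open>\<alpha> t\<^sup>\<alpha>\<^sup>-\<^sup>1\<close> does not increase in \<open>t\<close>, so on
  \<open>[x, y]\<close> it is at most \<open>x\<^sup>\<alpha>\<^sup>-\<^sup>1\<close>.
\<close>

lemma powr_weighted_diff_le:
  fixes x y \<alpha> \<beta> :: real
  assumes "0 \<le> \<alpha>" "\<alpha> \<le> 1" "0 < x" "x \<le> y"
  shows "x powr \<beta> * (y powr \<alpha> - x powr \<alpha>) \<le> (y - x) / x powr (1 - \<alpha> - \<beta>)"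
proof (cases "x = y")
  case False
  then have xy: "x < y" using assms by simp
  have "\<exists>t. x < t \<and> t < y \<and> y powr \<alpha> - x powr \<alpha> = (y - x) * (\<alpha> * t powr (\<alpha> - 1))"
    using xy assms by (intro MVT2) (auto intro!: derivative_eq_intros)
  then obtain t where t: "x < t" "t < y"
    "y powr \<alpha> - x powr \<alpha> = (y - x) * (\<alpha> * t powr (\<alpha> - 1))" by blast
  have "\<alpha> * t powr (\<alpha> - 1) \<le> 1 * x powr (\<alpha> - 1)"
    using t assms by (intro mult_mono powr_mono2') auto
  then have "y powr \<alpha> - x powr \<alpha> \<le> (y - x) * x powr (\<alpha> - 1)"
    unfolding t(3) using xy by (intro mult_left_mono) auto
  then have "x powr \<beta> * (y powr \<alpha> - x powr \<alpha>) \<le> x powr \<beta> * ((y - x) * x powr (\<alpha> - 1))"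
    by (intro mult_left_mono) auto
  also have "\<dots> = (y - x) * x powr (-(1 - \<alpha> - \<beta>))"
    by (simp add: powr_add[symmetric] algebra_simps)
  also have "\<dots> = (y - x) / x powr (1 - \<alpha> - \<beta>)"
    by (simp only: powr_minus_divide) simp
  finally show ?thesis .
qed simp

theorem theorem1:
  fixes \<alpha> \<beta> :: real
  assumes "\<alpha> \<ge> 0" and "\<beta> \<ge> 0" and "\<alpha> + \<beta> < 1"
  shows "liminf (\<lambda>n. ereal (real (nth_prime n) powr \<beta> *
           (real (nth_prime (n + 1)) powr \<alpha> - real (nth_prime n) powr \<alpha>))) = 0"
    (is "liminf ?f = 0")
proof (rule antisym)
  have mono: "nth_prime n \<le> nth_prime (n + 1)" for n
    using primes_infinite by (simp add: nth_prime_def)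
  have ge1: "real (nth_prime n) \<ge> 1" for n
    using prime_ge_1_nat[OF prime_nth_prime] by simp
  show "0 \<le> liminf ?f"
  proof (intro Liminf_bounded always_eventually allI)
    fix n
    have "real (nth_prime n) powr \<alpha> \<le> real (nth_prime (n + 1)) powr \<alpha>"
      using mono[of n] \<open>\<alpha> \<ge> 0\<close> by (intro powr_mono2) auto
    then show "0 \<le> ?f n" by simp
  qed
  show "liminf ?f \<le> 0"
  proof (rule ccontr)
    assume "\<not> liminf ?f \<le> 0"
    then obtain c where c: "0 < ereal c" "ereal c < liminf ?f"
      using ereal_dense2[of 0 "liminf ?f"] by (auto simp: not_le)
    define \<epsilon> where "\<epsilon> = 1 - \<alpha> - \<beta>"
    have "\<forall>\<^sub>F n in sequentially.
            real (nth_prime n) + c * real (nth_prime n) powr \<epsilon> \<le> real (nth_prime (Suc n))"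
      using less_LiminfD[OF c(2)]
    proof eventually_elim
      case (elim n)
      have "c \<le> real (nth_prime n) powr \<beta> *
              (real (nth_prime (n + 1)) powr \<alpha> - real (nth_prime n) powr \<alpha>)"
        using elim by simp
      also have "\<dots> \<le> (real (nth_prime (n + 1)) - real (nth_prime n)) / real (nth_prime n) powr \<epsilon>"
        unfolding \<epsilon>_def using assms mono[of n] ge1[of n] by (intro powr_weighted_diff_le) auto
      finally show ?case
        using ge1[of n] by (simp add: pos_le_divide_eq)
    qed
    then have "summable (\<lambda>n. 1 / real (nth_prime n))"
      using c assms ge1 by (intro summable_inverse_of_powr_gaps[of c \<epsilon>]) (auto simp: \<epsilon>_def)
    then show False using not_summable_inverse_nth_prime by contradiction
  qed
qed

end
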